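(* For any $\gamma>0$, there exists some $d_0=d_0(\gamma)$ such that $\mathrm{PL}_{d_0}(\gamma)$ fails. Quantitatively, we have $d_0(\gamma)=\exp(O(\gamma^{-1}))$.
   Context: For a point $p$ and a line $\ell$ in $\mathbb{R}^d$, $d_\infty(p,\ell):=\min_{q\in\ell}\|p-q\|_\infty$. For a dimension $d$ and a real number $\gamma$, $\mathrm{PL}_d(\gamma)$ is the following proposition: for every large $n$ and any points $p_1,\dots,p_n\in[0,1]^d$ and lines $\ell_1,\dots,\ell_n$ with $p_i\in\ell_i$, there exist $i\neq j$ with $d_\infty(p_i,\ell_j)\le n^{-\frac{1}{d-\gamma}+o(1)}$. Here $o(1)$ denotes a quantity tending to $0$ as $n\to\infty$. The notation $f=O(g)$ means that there is a positive constant $C$ such that $|f(x)|\le C g(x)$ for all $x$.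
   Formalization: The bound d_0(γ)=exp(O(1/γ)) is proved with a constant C for each bounded range 0<γ≤Γ, depending on Γ; one C for all γ>0 is impossible, since large γ would force d_0≤1, where PL holds. *)

theory Defs
  imports Complex_Main "Jordan_Normal_Form.Matrix"
begin

text \<open>
  The dimension is quantified over inside the statement, so \<open>\<real>\<^sup>d\<close> is rendered as
  \<^term>\<open>carrier_vec d :: real vec set\<close>.
\<close>

text \<open>The inserted 0 only matters in dimension 0, where it makes the norm of the empty vector 0.\<close>

definition sup_norm :: "real vec \<Rightarrow> real" where
  "sup_norm v = Max (insert 0 ((\<lambda>i. \<bar>v $ i\<bar>) ` {..<dim_vec v}))"

definition unit_cube :: "nat \<Rightarrow> real vec set" where
  "unit_cube d = {p \<in> carrier_vec d. \<forall>i<d. 0 \<le> p $ i \<and> p $ i \<le> 1}"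

definition is_line :: "nat \<Rightarrow> real vec set \<Rightarrow> bool" where
  "is_line d l \<longleftrightarrow>
    (\<exists>a\<in>carrier_vec d. \<exists>v\<in>carrier_vec d. v \<noteq> 0\<^sub>v d \<and> l = {a + t \<cdot>\<^sub>v v |t. True})"

text \<open>The infimum over a line is a minimum; see \<open>dist_line_attained\<close> below.\<close>

definition dist_line :: "real vec \<Rightarrow> real vec set \<Rightarrow> real" where
  "dist_line p l = (INF q\<in>l. sup_norm (p - q))"

text \<open>
  The \<open>o(1)\<close> in the exponent is a null sequence \<open>\<epsilon>\<close> that depends only on \<open>d\<close> and \<open>\<gamma>\<close>,
  not on the configuration of points and lines. Points and lines are indexed families, which
  need not be injective.
\<close>

definition PL :: "nat \<Rightarrow> real \<Rightarrow> bool" where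
  "PL d \<gamma> \<longleftrightarrow>
    (\<exists>\<epsilon>::nat \<Rightarrow> real. \<epsilon> \<longlonglongrightarrow> 0 \<and>
      (\<forall>\<^sub>F n in sequentially.
        \<forall>(p :: nat \<Rightarrow> real vec) (l :: nat \<Rightarrow> real vec set).
          (\<forall>i\<in>{1..n}. p i \<in> unit_cube d \<and> is_line d (l i) \<and> p i \<in> l i) \<longrightarrow>
          (\<exists>i\<in>{1..n}. \<exists>j\<in>{1..n}. i \<noteq> j \<and>
            dist_line (p i) (l j) \<le> real n powr (- (1 / (real d - \<gamma>)) + \<epsilon> n))))"

lemma sup_norm_le_iff:
  "sup_norm v \<le> r \<longleftrightarrow> 0 \<le> r \<and> (\<forall>i<dim_vec v. \<bar>v $ i\<bar> \<le> r)"
  unfolding sup_norm_def by (subst Max_le_iff) auto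

lemma index_le_sup_norm: "i < dim_vec v \<Longrightarrow> \<bar>v $ i\<bar> \<le> sup_norm v"
  using sup_norm_le_iff[of v "sup_norm v"] by simp

lemma sup_norm_nonneg: "0 \<le> sup_norm v"
  using sup_norm_le_iff[of v "sup_norm v"] by simp

lemma dist_line_attained:
  assumes p: "p \<in> carrier_vec d" and l: "is_line d l"
  shows "\<exists>q\<in>l. dist_line p l = sup_norm (p - q) \<and> (\<forall>q'\<in>l. sup_norm (p - q) \<le> sup_norm (p - q'))"
proof -
  obtain a v where a: "a \<in> carrier_vec d" and v: "v \<in> carrier_vec d" "v \<noteq> 0\<^sub>v d"
    and leq: "l = {a + t \<cdot>\<^sub>v v |t. True}"
    using l unfolding is_line_def by blast
  obtain k where k: "k < d" "v $ k \<noteq> 0"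
    using v by (metis carrier_vecD eq_vecI index_zero_vec)
  define f where "f t = sup_norm (p - (a + t \<cdot>\<^sub>v v))" for t
  have idx: "(p - (a + t \<cdot>\<^sub>v v)) $ i = p $ i - a $ i - t * v $ i" if "i < d" for t i
    using that p a v by simp
  have dim: "dim_vec (p - (a + t \<cdot>\<^sub>v v)) = d" for t
    using v by simp
  have lip: "f s \<le> f t + sup_norm v * \<bar>s - t\<bar>" for s t
  proof -
    have "\<bar>p $ i - a $ i - s * v $ i\<bar> \<le> f t + sup_norm v * \<bar>s - t\<bar>" if i: "i < d" for i
    proof -
      have 1: "\<bar>p $ i - a $ i - t * v $ i\<bar> \<le> f t"
        using index_le_sup_norm[of i "p - (a + t \<cdot>\<^sub>v v)"] i unfolding f_def dim idx[OF i] by simp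
      have "\<bar>v $ i\<bar> \<le> sup_norm v"
        using index_le_sup_norm[of i v] i v by simp
      then have 2: "\<bar>(t - s) * v $ i\<bar> \<le> sup_norm v * \<bar>s - t\<bar>"
        using mult_right_mono[of "\<bar>v $ i\<bar>" "sup_norm v" "\<bar>s - t\<bar>"]
        by (simp add: abs_mult abs_minus_commute mult.commute)
      have "p $ i - a $ i - s * v $ i = (p $ i - a $ i - t * v $ i) + (t - s) * v $ i"
        by (simp add: algebra_simps)
      then show ?thesis using 1 2 by linarith
    qed
    moreover have "0 \<le> f t + sup_norm v * \<bar>s - t\<bar>"
      unfolding f_def by (intro add_nonneg_nonneg mult_nonneg_nonneg sup_norm_nonneg) simp
    ultimately show ?thesis
      unfolding f_def[of s] sup_norm_le_iff dim by (simp add: idx)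
  qed
  have cont: "continuous_on S f" for S
  proof (rule continuous_at_imp_continuous_on, rule ballI)
    fix t
    have "((\<lambda>s. sup_norm v * \<bar>s - t\<bar>) \<longlongrightarrow> sup_norm v * \<bar>t - t\<bar>) (at t)"
      by (intro tendsto_intros)
    then have z: "((\<lambda>s. sup_norm v * \<bar>s - t\<bar>) \<longlongrightarrow> 0) (at t)" by simp
    have "norm (f s - f t) \<le> sup_norm v * \<bar>s - t\<bar>" for s
      using lip[of s t] lip[of t s] by (simp add: abs_le_iff abs_minus_commute)
    then have "((\<lambda>s. f s - f t) \<longlongrightarrow> 0) (at t)"
      by (intro tendsto_0_le[OF z, where K = 1]) (simp add: abs_mult sup_norm_nonneg)
    then show "isCont f t"
      unfolding isCont_def by (simp add: LIM_zero_iff)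
  qed
  define T where "T = (f 0 + \<bar>p $ k - a $ k\<bar>) / \<bar>v $ k\<bar>"
  have T0: "0 \<le> T" unfolding T_def f_def using sup_norm_nonneg by simp
  have "\<exists>x\<in>{-T..T}. \<forall>y\<in>{-T..T}. f x \<le> f y"
    by (rule continuous_attains_inf) (use T0 cont in auto)
  then obtain x where x: "\<And>y. y \<in> {-T..T} \<Longrightarrow> f x \<le> f y" by blast
  have min: "f x \<le> f y" for y
  proof (cases "\<bar>y\<bar> \<le> T")
    case True
    then show ?thesis using x[of y] by (simp add: abs_le_iff)
  next
    case False
    then have "f 0 + \<bar>p $ k - a $ k\<bar> < \<bar>y * v $ k\<bar>"
      using k unfolding T_def by (simp add: abs_mult field_simps)
    moreover have "\<bar>p $ k - a $ k - y * v $ k\<bar> \<le> f y"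
      using index_le_sup_norm[of k "p - (a + y \<cdot>\<^sub>v v)"] k unfolding f_def dim idx[OF k(1)] by simp
    ultimately have "f 0 \<le> f y" by linarith
    moreover have "f x \<le> f 0" using x[of 0] T0 by simp
    ultimately show ?thesis by simp
  qed
  let ?q = "a + x \<cdot>\<^sub>v v"
  have q: "?q \<in> l" and all: "\<forall>q'\<in>l. sup_norm (p - ?q) \<le> sup_norm (p - q')"
    using min unfolding leq f_def by auto
  moreover have "dist_line p l = sup_norm (p - ?q)"
    unfolding dist_line_def by (rule cInf_eq_minimum) (use q all in auto)
  ultimately show ?thesis by blast
qed

end

theory Submission
  imports Defs "HOL-Number_Theory.Number_Theory" "HOL-Computational_Algebra.Polynomial"
begin

text \<open>
  Fix a prime \<open>p\<close> and consider integer points in a box of side \<open>Q\<close>, a power of \<open>p\<close>. The form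
  \<open>f(x, w) = \<Sum> w\<^sub>i x\<^sup>i\<close> in \<open>p\<close> variables has, at every integer point, an integer direction
  \<open>(1, V)\<close> along which \<open>f\<close> grows by exactly \<open>n\<^bsup>p-1\<^esup>\<close> after \<open>n\<close> steps. By Fermat, if \<open>p\<^sup>l\<close> is the
  exact power of \<open>p\<close> in \<open>n\<close>, this changes the base-\<open>p\<close> digit of \<open>f\<close> of index \<open>(p-1)l\<close> by exactly one.
  Hence, on the set where \<open>s\<close> such digits have prescribed classes of a proper 3-colouring of
  \<open>\<int>/p\<close>, a set of density about \<open>3\<^bsup>-s\<^esup>\<close>, the walk avoids the set unless \<open>p\<^sup>s\<close> divides \<open>n\<close>.

  Only the residue of \<open>V\<close> modulo \<open>q = p\<^bsup>(p-1)s\<^esup>\<close> matters, so the walk is realised by a line with slopes \<open>V/q\<close>,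
  sampled at times that are nearly multiples of \<open>q\<close>; meeting the set again is then possible only at
  times that are nearly multiples of \<open>q p\<^sup>s\<close>. These are the sampling times for a further block of \<open>p\<close>
  coordinates with the larger modulus \<open>q p\<^sup>s\<close>, and so on through \<open>J\<close> blocks; the initial sampling
  is enforced by a single coordinate, restricted to a progression. The resulting set has at least
  \<open>Q\<^bsup>d-\<gamma>'\<^esup>\<close> points, where \<open>d = 1 + J p\<close> and \<open>\<gamma>' = ln 3 / ln p + (1 - 1/p)\<^sup>J\<close>. Taking \<open>J = p\<^sup>2\<close> and
  \<open>ln p\<close> of order \<open>1/\<gamma>\<close> makes \<open>\<gamma>' < \<gamma>\<close> while \<open>ln d = O(1/\<gamma>)\<close>.
\<close>

section \<open>Primes between \<open>X\<close> and \<open>2 X\<^sup>2 + 1\<close>\<close>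

text \<open>The sum is the Beta integral of x^(a-1) (1-x)^m over the unit interval, expanded
  termwise. By Pascal's rule F(m+1, a) = F(m, a) - F(m, a+1), a recurrence that the right-hand side
  also satisfies.\<close>

lemma sum_alternating_binomial_inverse:
  fixes a :: real
  assumes "a > 0"
  shows "(\<Sum>i\<le>m. (-1) ^ i * real (m choose i) / (a + real i)) = fact m / pochhammer a (Suc m)"
  using assms
proof (induction m arbitrary: a)
  case 0
  then show ?case by simp
next
  case (Suc m)
  have "(\<Sum>i\<le>Suc m. (-1) ^ i * real (Suc m choose i) / (a + real i)) =
      1 / a + (\<Sum>i\<le>m. (-1) ^ Suc i * real (Suc m choose Suc i) / (a + real (Suc i)))"
    by (subst sum.atMost_Suc_shift) simp
  also have "(\<Sum>i\<le>m. (-1) ^ Suc i * real (Suc m choose Suc i) / (a + real (Suc i))) =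
      (\<Sum>i\<le>m. (-1) ^ Suc i * real (m choose Suc i) / (a + real (Suc i))) -
      (\<Sum>i\<le>m. (-1) ^ i * real (m choose i) / (a + 1 + real i))"
    unfolding sum_subtractf [symmetric]
  proof (intro sum.cong refl)
    fix i
    have z: "a + real (Suc i) = a + 1 + real i" by simp
    show "(-1) ^ Suc i * real (Suc m choose Suc i) / (a + real (Suc i)) =
        (-1) ^ Suc i * real (m choose Suc i) / (a + real (Suc i)) - (-1) ^ i * real (m choose i) / (a + 1 + real i)"
      unfolding z binomial_Suc_Suc of_nat_add power_Suc divide_inverse by (simp add: algebra_simps)
  qed
  also have "1 / a + ((\<Sum>i\<le>m. (-1) ^ Suc i * real (m choose Suc i) / (a + real (Suc i))) -
      (\<Sum>i\<le>m. (-1) ^ i * real (m choose i) / (a + 1 + real i))) =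
      (\<Sum>i\<le>Suc m. (-1) ^ i * real (m choose i) / (a + real i)) -
      (\<Sum>i\<le>m. (-1) ^ i * real (m choose i) / (a + 1 + real i))"
  proof -
    have "(\<Sum>i\<le>Suc m. (-1) ^ i * real (m choose i) / (a + real i)) =
        1 / a + (\<Sum>i\<le>m. (-1) ^ Suc i * real (m choose Suc i) / (a + real (Suc i)))"
      by (subst sum.atMost_Suc_shift) simp
    then show ?thesis by linarith
  qed
  also have "(\<Sum>i\<le>Suc m. (-1) ^ i * real (m choose i) / (a + real i)) =
      (\<Sum>i\<le>m. (-1) ^ i * real (m choose i) / (a + real i))"
    by simp
  also have "\<dots> - (\<Sum>i\<le>m. (-1) ^ i * real (m choose i) / (a + 1 + real i)) =
      fact m / pochhammer a (Suc m) - fact m / pochhammer (a + 1) (Suc m)"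
    using Suc.IH[of a] Suc.IH[of "a + 1"] Suc.prems by simp
  also have "\<dots> = fact (Suc m) / pochhammer a (Suc (Suc m))"
  proof -
    have pos: "pochhammer (a + 1) m > 0" using Suc.prems by (intro pochhammer_pos) simp
    have 1: "pochhammer a (Suc m) = a * pochhammer (a + 1) m"
      by (simp add: pochhammer_rec)
    have 2: "pochhammer (a + 1) (Suc m) = pochhammer (a + 1) m * (a + 1 + real m)"
      by (simp add: pochhammer_Suc)
    have 3: "pochhammer a (Suc (Suc m)) = a * (pochhammer (a + 1) m * (a + 1 + real m))"
      by (subst pochhammer_rec) (simp add: 2)
    have "a \<noteq> 0" "a + 1 + real m \<noteq> 0" using Suc.prems by auto
    then show ?thesis unfolding 1 2 3 using pos
      by (simp add: divide_simps) (simp add: algebra_simps)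
  qed
  finally show ?case .
qed

text \<open>Needed to bound the Beta value (n!)^2 / (2n+1)! by 4^(-n).\<close>

lemma four_power_fact_square_le: "4 ^ n * (fact n)\<^sup>2 \<le> (fact (2 * n + 1) :: real)"
proof (induction n)
  case (Suc n)
  have "4 ^ Suc n * (fact (Suc n))\<^sup>2 = (4 ^ n * (fact n)\<^sup>2) * (4 * (real n + 1)\<^sup>2)"
    by (simp add: power2_eq_square algebra_simps)
  also have "\<dots> \<le> fact (2 * n + 1) * ((2 * real n + 3) * (2 * real n + 2))"
  proof (rule mult_mono [OF Suc.IH])
    show "4 * (real n + 1)\<^sup>2 \<le> (2 * real n + 3) * (2 * real n + 2)"
      unfolding power2_eq_square by (simp add: algebra_simps)
  qed simp_all
  also have "\<dots> = fact (2 * Suc n + 1)"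
    by (simp add: algebra_simps)
  finally show ?case .
qed simp

text \<open>\<open>D \<integral> x\<^sup>n (1 - x)\<^sup>n dx\<close> over the unit interval is an integer, positive and at most \<open>D / 4\<^sup>n\<close>;
  below, \<open>S\<close> is the integral, expanded termwise.\<close>

lemma four_power_le_common_multiple:
  assumes D: "D > 0" "\<And>i. i \<in> {1..2 * n + 1} \<Longrightarrow> i dvd D"
  shows "4 ^ n \<le> (D :: nat)"
proof -
  define S where "S = (\<Sum>i\<le>n. (-1) ^ i * real (n choose i) / (real (n + 1) + real i))"
  have S: "S = fact n / pochhammer (real (n + 1)) (Suc n)"
    unfolding S_def by (rule sum_alternating_binomial_inverse) simp
  have ff: "pochhammer (real (n + 1)) (Suc n) * fact n = fact (2 * n + 1)"
  proof -
    have "pochhammer (1::real) (n + Suc n) = pochhammer 1 n * pochhammer (1 + real n) (Suc n)"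
      by (rule pochhammer_product')
    then show ?thesis
      by (simp add: pochhammer_fact [symmetric] mult_2 mult_2_right add.commute mult.commute del: fact_Suc)
  qed
  have pp: "pochhammer (real (n + 1)) (Suc n) > 0" by (intro pochhammer_pos) simp
  have S0: "S > 0" unfolding S using pp by simp
  have "S = (fact n)\<^sup>2 / fact (2 * n + 1)"
    unfolding S ff [symmetric] using pp by (simp add: power2_eq_square)
  also have "\<dots> \<le> 1 / 4 ^ n"
    using four_power_fact_square_le[of n] by (simp add: divide_simps mult.commute del: fact_Suc)
  finally have S1: "S \<le> 1 / 4 ^ n" .
  have "real D * S \<in> \<int>"
    unfolding S_def sum_distrib_left
  proof (rule Ints_sum)
    fix i assume i: "i \<in> {..n}"
    then have "n + 1 + i dvd D" by (intro D) auto
    then obtain c where c: "D = (n + 1 + i) * c" by blast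
    have "real D * ((-1) ^ i * real (n choose i) / (real (n + 1) + real i)) = real c * ((-1) ^ i * real (n choose i))"
      unfolding c of_nat_mult of_nat_add by (simp add: field_simps)
    also have "\<dots> \<in> \<int>" by (intro Ints_mult Ints_power) auto
    finally show "real D * ((-1) ^ i * real (n choose i) / (real (n + 1) + real i)) \<in> \<int>" .
  qed
  moreover have "real D * S > 0" using D S0 by simp
  ultimately have "1 \<le> real D * S" by (auto elim!: Ints_cases)
  also have "\<dots> \<le> real D * (1 / 4 ^ n)" by (intro mult_left_mono S1) simp
  finally have "real (4 ^ n) \<le> real D" by (simp add: field_simps)
  then show ?thesis unfolding of_nat_le_iff .
qed

text \<open>Without such a prime, \<open>D\<close> is the least common multiple of 1, ..., N. It
  involves at most \<open>X\<close> primes, each contributing a factor of at most \<open>N\<close>,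
  so D <= N^X < 4^(X^2). But \<open>four_power_le_common_multiple\<close> with n = X^2 gives 4^(X^2)
  <= D; hence the choice N = 2 X^2 + 1.\<close>

lemma exists_prime_between:
  assumes X: "X \<ge> (1::nat)"
  shows "\<exists>p. prime p \<and> X < p \<and> p \<le> 2 * X\<^sup>2 + 1"
proof (rule ccontr)
  assume none: "\<not> ?thesis"
  define N where "N = 2 * X\<^sup>2 + 1"
  define e where "e p = Max {k. p ^ k \<le> N}" for p
  define D where "D = (\<Prod>p | prime p \<and> p \<le> X. p ^ e p)"
  have fin: "finite {k. p ^ k \<le> N}" if "prime p" for p
  proof (rule finite_subset)
    show "{k. p ^ k \<le> N} \<subseteq> {..N}"
    proof
      fix k assume "k \<in> {k. p ^ k \<le> N}"
      moreover have "k < p ^ k" using that prime_gt_1_nat by (intro power_gt_expt) auto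
      ultimately show "k \<in> {..N}" by simp
    qed
  qed simp
  have N1: "N \<ge> 1" unfolding N_def by simp
  have e_le: "p ^ e p \<le> N" if "prime p" for p
  proof -
    have "0 \<in> {k. p ^ k \<le> N}" using N1 by simp
    then have "e p \<in> {k. p ^ k \<le> N}" unfolding e_def by (intro Max_in fin that) blast
    then show ?thesis by simp
  qed
  have D0: "D > 0" unfolding D_def by (intro prod_pos) (auto simp: prime_gt_0_nat)
  have "i dvd D" if i: "i \<in> {1..2 * X\<^sup>2 + 1}" for i
  proof (rule multiplicity_le_imp_dvd)
    show "i \<noteq> 0" using i by simp
    fix q :: nat assume q: "prime q"
    show "multiplicity q i \<le> multiplicity q D"
    proof (cases "q dvd i")
      case False
      then show ?thesis by (simp add: not_dvd_imp_multiplicity_0)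
    next
      case True
      then have "q \<le> N" using i unfolding N_def by (auto dest: dvd_imp_le)
      then have "q \<le> X" using none q unfolding N_def by (meson not_le)
      then have "q ^ e q dvd D" unfolding D_def using q by (intro dvd_prodI) auto
      moreover have "q ^ multiplicity q i \<le> N"
        using i multiplicity_dvd[of q i] unfolding N_def by (auto dest: dvd_imp_le)
      then have "multiplicity q i \<le> e q" unfolding e_def using fin[OF q] by simp
      ultimately show ?thesis
        using D0 q by (intro multiplicity_geI) (auto intro: dvd_trans le_imp_power_dvd)
    qed
  qed
  then have "4 ^ (X\<^sup>2) \<le> D" using D0 by (intro four_power_le_common_multiple) auto
  also have "D \<le> (\<Prod>p | prime p \<and> p \<le> X. N)"
    unfolding D_def by (intro prod_mono) (auto intro: e_le)
  also have "\<dots> = N ^ card {p. prime p \<and> p \<le> X}" by simp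
  also have "\<dots> \<le> N ^ X"
  proof (rule power_increasing[OF _ N1])
    have "card {p. prime p \<and> p \<le> X} \<le> card {1..X}"
      by (intro card_mono) (auto dest: prime_ge_1_nat)
    then show "card {p. prime p \<and> p \<le> X} \<le> X" by simp
  qed
  also have "N < 4 ^ X"
    unfolding N_def using X
  proof (induction X rule: dec_induct)
    case (step n)
    then have "n \<le> n\<^sup>2" by (simp add: power2_eq_square)
    then have "4 * n \<le> 6 * n\<^sup>2 + 1" by linarith
    have "2 * (Suc n)\<^sup>2 + 1 = 2 * n\<^sup>2 + 4 * n + 3" by (simp add: power2_eq_square)
    also have "\<dots> \<le> 4 * (2 * n\<^sup>2 + 1)" using \<open>4 * n \<le> 6 * n\<^sup>2 + 1\<close> by simp
    also have "\<dots> < 4 * 4 ^ n" using step.IH by simp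
    finally show ?case by simp
  qed simp
  then have "N ^ X < (4 ^ X) ^ X" using X by (intro power_strict_mono) auto
  finally show False by (simp add: power_mult [symmetric] power2_eq_square)
qed

section \<open>A form changing by \<open>n\<^bsup>p-1\<^esup>\<close> along lines\<close>

text \<open>Factor W(z) - W(x) = (z - x) R(z) and take as slopes the coefficients of U(z) = (z -
  x)^(k-1) - R(z), a polynomial of degree below \<open>k\<close>. At z = x + n the summand n U(z)
  cancels n R(z) and leaves n^k.\<close>

lemma exists_polynomial_slope:
  fixes w :: "nat \<Rightarrow> int" and x :: int
  assumes k: "k > 0"
  shows "\<exists>V. \<forall>n. (\<Sum>i<k. (w i + n * V i) * (x + n) ^ i) = (\<Sum>i<k. w i * x ^ i) + n ^ k"
proof -
  define W where "W = (\<Sum>i<k. Polynomial.monom (w i) i)"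
  have W: "poly W z = (\<Sum>i<k. w i * z ^ i)" for z
    unfolding W_def by (simp add: poly_sum poly_monom)
  have dW: "Polynomial.degree (W - [:poly W x:]) < k"
  proof -
    have "Polynomial.degree W < k"
      unfolding W_def using k by (intro degree_sum_less) (auto intro: le_less_trans[OF degree_monom_le])
    then show ?thesis using k by (intro degree_diff_less) auto
  qed
  have "[:-x, 1:] dvd W - [:poly W x:]"
    by (simp flip: poly_eq_0_iff_dvd)
  then obtain R where R: "W - [:poly W x:] = [:-x, 1:] * R" by blast
  have dR: "Polynomial.degree R < k"
  proof (cases "R = 0")
    case False
    then have "Polynomial.degree ([:-x, 1:] * R) = Suc (Polynomial.degree R)"
      by (subst degree_mult_eq) auto
    then show ?thesis using dW unfolding R by simp
  qed (use k in simp)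
  define U where "U = [:-x, 1:] ^ (k - 1) - R"
  have "Polynomial.degree U < k"
    unfolding U_def using k dR by (intro degree_diff_less) (auto simp: degree_linear_power)
  then have U: "poly U z = (\<Sum>i<k. Polynomial.coeff U i * z ^ i)" for z
  proof -
    have "{..<k} = {..k - 1}" using k by auto
    moreover have "(\<Sum>i\<le>k - 1. Polynomial.monom (Polynomial.coeff U i) i) = U"
      using \<open>Polynomial.degree U < k\<close> by (intro poly_as_sum_of_monoms') simp
    ultimately have "poly U z = poly (\<Sum>i<k. Polynomial.monom (Polynomial.coeff U i) i) z" by simp
    then show ?thesis by (simp add: poly_sum poly_monom)
  qed
  have "(\<Sum>i<k. (w i + n * Polynomial.coeff U i) * (x + n) ^ i) = (\<Sum>i<k. w i * x ^ i) + n ^ k" for n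
  proof -
    have "poly (W - [:poly W x:]) (x + n) = n * poly R (x + n)"
      unfolding R by (simp add: algebra_simps)
    then have 1: "poly W (x + n) - poly W x = n * poly R (x + n)" by simp
    have 2: "n * poly U (x + n) = n ^ k - n * poly R (x + n)"
      unfolding U_def using k by (cases k) (simp_all add: poly_power algebra_simps)
    have "(\<Sum>i<k. (w i + n * Polynomial.coeff U i) * (x + n) ^ i) = poly W (x + n) + n * poly U (x + n)"
      unfolding W U by (simp add: sum.distrib sum_distrib_left algebra_simps)
    also have "\<dots> = poly W x + n ^ k" using 1 2 by simp
    finally show ?thesis unfolding W .
  qed
  then show ?thesis by blast
qed

section \<open>Colouring base-\<open>p\<close> digits\<close>

text \<open>A proper colouring of the cycle \<open>\<int>/p\<close>; two colours would not do for odd \<open>p\<close>.\<close>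

definition cycle_color :: "int \<Rightarrow> int \<Rightarrow> nat" where
  "cycle_color p c = (if c = p - 1 then 2 else nat (c mod 2))"

lemma cycle_color_less_3: "cycle_color p c < 3"
  unfolding cycle_color_def by (auto simp: nat_less_iff intro: less_trans[of _ 2])

text \<open>Below p-1 the colours alternate by parity, and the colour 2 of p-1 occurs at neither of
  its neighbours p-2 and 0.\<close>

lemma cycle_color_succ:
  assumes "2 \<le> p" "0 \<le> c" "c < p"
  shows "cycle_color p ((c + 1) mod p) \<noteq> cycle_color p c"
proof (cases "c = p - 1")
  case True
  then show ?thesis using assms by (simp add: cycle_color_def)
next
  case False
  then have "(c + 1) mod p = c + 1" using assms by simp
  moreover have "c mod 2 = 0 \<and> (c + 1) mod 2 = 1 \<or> c mod 2 = 1 \<and> (c + 1) mod 2 = 0"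
    by presburger
  ultimately show ?thesis using False by (auto simp: cycle_color_def)
qed

text \<open>Only digits at multiples of p-1 are read: if \<open>p^l\<close> is the exact power of
  \<open>p\<close> in \<open>n\<close>, then (p-1)l is the lowest index at which adding n^(p-1)
  changes a digit.\<close>

definition digit_color :: "nat \<Rightarrow> int \<Rightarrow> nat \<Rightarrow> nat" where
  "digit_color p e l = cycle_color (int p) (e div int p ^ ((p - 1) * l) mod int p)"

text \<open>Otherwise n = p^l u with l < \<sigma> and u prime to p. As u^(p-1) is 1 modulo p, the
  digit of index (p-1)l moves to its cyclic successor, whose colour differs.\<close>

lemma prime_power_dvd_if_same_digit_colors:
  fixes e e' n :: int
  assumes p: "prime p"
    and cong: "[e' = e + n ^ (p - 1)] (mod int p ^ ((p - 1) * \<sigma>))"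
    and same: "\<And>l. l < \<sigma> \<Longrightarrow> digit_color p e l = digit_color p e' l"
  shows "int p ^ \<sigma> dvd n"
proof (rule ccontr)
  assume nd: "\<not> int p ^ \<sigma> dvd n"
  then have n0: "n \<noteq> 0" by auto
  have pp: "prime (int p)" using p by simp
  have p2: "int p \<ge> 2" using p prime_ge_2_nat by fastforce
  define k where "k = p - 1"
  define l where "l = multiplicity (int p) n"
  have l: "l < \<sigma>" unfolding l_def using nd multiplicity_dvd' not_le by blast
  obtain u where u: "n = int p ^ l * u" "\<not> int p dvd u"
    unfolding l_def using n0 pp by (elim multiplicity_decompose') (auto simp: prime_elem_not_unit)
  have uk: "[u ^ k = 1] (mod int p)"
  proof -
    define v where "v = nat (u mod int p)"
    have v: "int v = u mod int p" unfolding v_def using p2 by simp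
    have "\<not> p dvd v"
    proof
      assume "p dvd v"
      then have "int p dvd int v" by simp
      then show False using u unfolding v by (simp add: dvd_mod_iff)
    qed
    then have "[v ^ k = 1] (mod p)" unfolding k_def by (rule fermat_theorem[OF p])
    then have "[int v ^ k = 1] (mod int p)" by (metis cong_int_iff of_nat_1 of_nat_power)
    moreover have "[int v ^ k = u ^ k] (mod int p)"
      unfolding v by (intro cong_pow) simp
    ultimately show ?thesis by (meson cong_sym cong_trans)
  qed
  obtain z where z: "e' = e + n ^ k + int p ^ (k * \<sigma>) * z"
    using cong unfolding k_def by (metis cong_iff_lin cong_sym)
  \<comment> \<open>The change of \<open>e\<close> in units of p^(kl). As l < \<sigma>, the unknown
    multiple of the modulus adds only a multiple of \<open>p\<close> to it.\<close>
  define y where "y = u ^ k + int p ^ (k * (\<sigma> - l)) * z"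
  have "k * \<sigma> = k * l + k * (\<sigma> - l)" using l by (simp flip: distrib_left)
  then have e': "e' = e + int p ^ (k * l) * y"
    unfolding z y_def u(1) \<open>k * \<sigma> = k * l + k * (\<sigma> - l)\<close>
    by (simp add: power_mult_distrib power_add distrib_left mult.commute[of l] flip: power_mult)
  have k0: "k > 0" unfolding k_def using p prime_ge_2_nat[of p] by simp
  have "[y = 1 + 0] (mod int p)"
    unfolding y_def
  proof (intro cong_add uk)
    have "int p dvd int p ^ (k * (\<sigma> - l)) * z" using k0 l by (intro dvd_mult2 dvd_power) auto
    then show "[int p ^ (k * (\<sigma> - l)) * z = 0] (mod int p)" by (simp add: cong_0_iff)
  qed
  then have y: "y mod int p = 1 mod int p" by (simp add: cong_def)
  define c where "c = e div int p ^ (k * l) mod int p"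
  have "e' div int p ^ (k * l) = e div int p ^ (k * l) + y"
    unfolding e' using p2 by simp
  then have "e' div int p ^ (k * l) mod int p = (c + 1) mod int p"
    unfolding c_def by (metis mod_add_eq mod_add_left_eq y mod_mod_trivial)
  then have "digit_color p e' l = cycle_color (int p) ((c + 1) mod int p)"
    unfolding digit_color_def k_def by simp
  moreover have "digit_color p e l = cycle_color (int p) c"
    unfolding digit_color_def c_def k_def by simp
  ultimately show False
    using same[OF l] cycle_color_succ[of "int p" c] p2 unfolding c_def by simp
qed

section \<open>The configuration of points and lines\<close>

text \<open>The recurrence amounts to \<open>modulus (Suc j) = modulus j * p ^ \<sigma> j\<close>: a
  step count divisible by \<open>p ^ \<sigma> j\<close> in block \<open>j\<close> turns a multiple
  of its modulus into a multiple of the next one.\<close>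

locale digit_tower =
  fixes p J :: nat and \<sigma> :: "nat \<Rightarrow> nat"
  assumes prime_p: "prime p"
    and step: "\<And>j. j < J \<Longrightarrow> (p - 1) * \<sigma> (Suc j) = p * \<sigma> j"
begin

definition modulus :: "nat \<Rightarrow> nat" where
  "modulus j = p ^ ((p - 1) * \<sigma> j)"

definition dimension :: nat where
  "dimension = Suc (J * p)"

text \<open>Coordinate 0 ranges up to the quotient of \<open>modulus J\<close> by
  \<open>modulus 0\<close>, because \<open>point\<close> spaces it in steps of
  \<open>modulus 0\<close>.\<close>

definition grid :: "(nat \<Rightarrow> nat) set" where
  "grid = (\<Pi>\<^sub>E m\<in>{..<dimension}. if m = 0 then {..<p ^ (\<Sum>j<J. \<sigma> j)} else {..<modulus J})"

text \<open>Coordinate \<open>0\<close> has unit speed and measures time; the others come in \<open>J\<close> blocks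
  \<open>(x, w\<^sub>0, \<dots>, w\<^bsub>p-2\<^esub>)\<close> of length \<open>p\<close>.\<close>

definition block :: "(nat \<Rightarrow> nat) \<Rightarrow> nat \<Rightarrow> nat \<Rightarrow> int" where
  "block a j i = int (a (Suc (j * p + i)))"

definition form :: "(nat \<Rightarrow> nat) \<Rightarrow> nat \<Rightarrow> int" where
  "form a j = (\<Sum>i<p - 1. block a j (Suc i) * block a j 0 ^ i)"

definition slope :: "(nat \<Rightarrow> nat) \<Rightarrow> nat \<Rightarrow> nat \<Rightarrow> int" where
  "slope a j = (SOME V. \<forall>n. (\<Sum>i<p - 1. (block a j (Suc i) + n * V i) * (block a j 0 + n) ^ i) =
    form a j + n ^ (p - 1))"

text \<open>Reducing the slopes keeps \<open>direction\<close> between 0 and 1, so that a timing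
  error moves a coordinate by no more than itself; modulo \<open>modulus j\<close> it does not
  affect \<open>form\<close>.\<close>

definition speed :: "(nat \<Rightarrow> nat) \<Rightarrow> nat \<Rightarrow> nat \<Rightarrow> int" where
  "speed a j i = (if i = 0 then 1 else slope a j (i - 1) mod int (modulus j))"

definition direction :: "(nat \<Rightarrow> nat) \<Rightarrow> real vec" where
  "direction a = vec dimension (\<lambda>m. if m = 0 then 1
    else of_int (speed a ((m - 1) div p) ((m - 1) mod p)) / real (modulus ((m - 1) div p)))"

definition point :: "(nat \<Rightarrow> nat) \<Rightarrow> real vec" where
  "point a = vec dimension
    (\<lambda>m. (if m = 0 then real (modulus 0) * real (a 0) else real (a m)) / real (modulus J))"

definition line :: "(nat \<Rightarrow> nat) \<Rightarrow> real vec set" where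
  "line a = {point a + t \<cdot>\<^sub>v direction a |t. True}"

definition same_color :: "(nat \<Rightarrow> nat) \<Rightarrow> (nat \<Rightarrow> nat) \<Rightarrow> bool" where
  "same_color a b \<longleftrightarrow>
    (\<forall>j<J. \<forall>l<\<sigma> j. digit_color p (form a j) l = digit_color p (form b j) l)"

section \<open>Elementary properties of the moduli, points and lines\<close>

lemma p_gt_1: "p > 1"
  using prime_p by (rule prime_gt_1_nat)

lemma modulus_pos [simp]: "modulus j > 0"
  unfolding modulus_def using p_gt_1 by simp

lemma modulus_ge_1: "modulus j \<ge> 1"
  using modulus_pos[of j] by linarith

lemma step': "j < J \<Longrightarrow> (p - 1) * \<sigma> (Suc j) = (p - 1) * \<sigma> j + \<sigma> j"
  using step[of j] p_gt_1 by (cases p) auto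

lemma modulus_Suc: "j < J \<Longrightarrow> modulus (Suc j) = modulus j * p ^ \<sigma> j"
  by (simp only: modulus_def step' power_add)

lemma sum_\<sigma>: "n \<le> J \<Longrightarrow> (p - 1) * \<sigma> n = (p - 1) * \<sigma> 0 + (\<Sum>j<n. \<sigma> j)"
  by (induction n) (simp_all add: step' del: One_nat_def)

lemma modulus_eq: "modulus J = modulus 0 * p ^ (\<Sum>j<J. \<sigma> j)"
  by (simp only: modulus_def sum_\<sigma>[OF order_refl] power_add)

lemma dim_point [simp]: "dim_vec (point a) = dimension"
  and dim_direction [simp]: "dim_vec (direction a) = dimension"
  by (simp_all add: point_def direction_def)

lemma point_carrier: "point a \<in> carrier_vec dimension"
  by (simp add: carrier_vecI)

lemma point_in_line: "point a \<in> line a"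
proof -
  have "point a = point a + 0 \<cdot>\<^sub>v direction a" by (intro eq_vecI) auto
  then show ?thesis unfolding line_def by blast
qed

lemma is_line_line: "is_line dimension (line a)"
proof -
  have "direction a $ 0 = 1" by (simp add: direction_def dimension_def)
  then have "direction a \<noteq> 0\<^sub>v dimension" by (auto simp: dimension_def)
  then show ?thesis
    unfolding is_line_def line_def
    by (intro bexI[of _ "point a"] bexI[of _ "direction a"]) (auto intro: carrier_vecI)
qed

lemma grid_less:
  assumes "a \<in> grid"
  shows "a 0 < p ^ (\<Sum>j<J. \<sigma> j)" "0 < m \<Longrightarrow> m < dimension \<Longrightarrow> a m < modulus J"
proof -
  show "a 0 < p ^ (\<Sum>j<J. \<sigma> j)"
    using PiE_mem[OF assms[unfolded grid_def], of 0] by (simp add: dimension_def)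
  show "a m < modulus J" if "0 < m" "m < dimension"
    using PiE_mem[OF assms[unfolded grid_def], of m] that by simp
qed

lemma point_in_unit_cube:
  assumes a: "a \<in> grid"
  shows "point a \<in> unit_cube dimension"
proof -
  have "0 \<le> point a $ m \<and> point a $ m \<le> 1" if m: "m < dimension" for m
  proof (cases "m = 0")
    case True
    have "modulus 0 * a 0 \<le> modulus J"
      unfolding modulus_eq using grid_less(1)[OF a] by (intro mult_left_mono) auto
    then have "real (modulus 0) * real (a 0) \<le> real (modulus J)"
      by (metis of_nat_mult of_nat_le_iff)
    then show ?thesis using True m by (simp add: point_def)
  next
    case False
    then have "a m < modulus J" using grid_less(2)[OF a _ m] by simp
    then show ?thesis using False m by (simp add: point_def)
  qed
  then show ?thesis using point_carrier by (simp add: unit_cube_def)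
qed

section \<open>Motion along a line and separation\<close>

lemma sum_slope:
  "(\<Sum>i<p - 1. (block a j (Suc i) + n * slope a j i) * (block a j 0 + n) ^ i) =
    form a j + n ^ (p - 1)"
proof -
  have "p - 1 > 0" using p_gt_1 by simp
  from exists_polynomial_slope[OF this, of "\<lambda>i. block a j (Suc i)" "block a j 0"]
  have "\<exists>V. \<forall>n. (\<Sum>i<p - 1. (block a j (Suc i) + n * V i) * (block a j 0 + n) ^ i) =
      form a j + n ^ (p - 1)"
    unfolding form_def .
  from someI_ex[OF this] show ?thesis unfolding slope_def by blast
qed

lemma speed_bounds: "0 \<le> speed a j i" "speed a j i \<le> int (modulus j)"
  unfolding speed_def using modulus_ge_1[of j]
  by (auto intro: less_imp_le simp del: modulus_pos simp: modulus_pos)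

lemma direction_block:
  assumes "j < J" "i < p"
  shows "Suc (j * p + i) < dimension"
    and "direction a $ Suc (j * p + i) = of_int (speed a j i) / real (modulus j)"
proof -
  have "Suc j * p \<le> J * p" using assms by (intro mult_right_mono) auto
  then show *: "Suc (j * p + i) < dimension" unfolding dimension_def using assms by simp
  show "direction a $ Suc (j * p + i) = of_int (speed a j i) / real (modulus j)"
    using * assms by (simp add: direction_def)
qed

lemma index_block:
  assumes "0 < m" "m < dimension"
  obtains j i where "j < J" "i < p" "m = Suc (j * p + i)"
proof
  show "(m - 1) div p < J" using assms p_gt_1
    by (auto simp: dimension_def div_less_iff_less_mult)
  show "(m - 1) mod p < p" using p_gt_1 by simp
  show "m = Suc ((m - 1) div p * p + (m - 1) mod p)" using assms by simp
qed

text \<open>Block by block, the time \<tau> of the near point \<open>q\<close> is shown to be within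
  1/4 of a multiple of \<open>modulus j\<close>; equality of colours leads from \<open>j\<close> to
  j+1. At j = J the range of coordinate 0 leaves only the multiple 0, and then all coordinates
  agree.\<close>

lemma eq_if_near_line:
  assumes a: "a \<in> grid" and b: "b \<in> grid" and same: "same_color a b"
    and q: "q \<in> line a" and near: "sup_norm (point b - q) \<le> 1 / (4 * real (modulus J))"
  shows "a = b"
proof -
  define Q where "Q = real (modulus J)"
  have Q1: "Q \<ge> 1" unfolding Q_def using modulus_ge_1[of J] by simp
  obtain t where t: "q = point a + t \<cdot>\<^sub>v direction a" using q unfolding line_def by blast
  \<comment> \<open>Scaling by \<open>Q\<close> makes the coordinates of the points integers and
    turns the tolerance 1/(4Q) into 1/4.\<close>
  define \<tau> where "\<tau> = t * Q"
  have coord: "\<bar>Q * point b $ m - Q * point a $ m - \<tau> * direction a $ m\<bar> \<le> 1 / 4"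
    if m: "m < dimension" for m
  proof -
    have "\<bar>(point b - q) $ m\<bar> \<le> 1 / (4 * Q)"
      using index_le_sup_norm[of m "point b - q"] near m unfolding t Q_def by simp
    then have "\<bar>point b $ m - point a $ m - t * direction a $ m\<bar> \<le> 1 / (4 * Q)"
      using m unfolding t by (simp add: diff_diff_eq)
    then have "Q * \<bar>point b $ m - point a $ m - t * direction a $ m\<bar> \<le> Q * (1 / (4 * Q))"
      using Q1 by (intro mult_left_mono) auto
    also have "Q * (1 / (4 * Q)) = 1 / 4" using Q1 by simp
    also have "Q * \<bar>point b $ m - point a $ m - t * direction a $ m\<bar> =
        \<bar>Q * (point b $ m - point a $ m - t * direction a $ m)\<bar>"
      using Q1 by (simp add: abs_mult)
    also have "Q * (point b $ m - point a $ m - t * direction a $ m) =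
        Q * point b $ m - Q * point a $ m - \<tau> * direction a $ m"
      unfolding \<tau>_def by (simp add: algebra_simps)
    finally show ?thesis .
  qed
  have clock: "\<bar>real (modulus 0) * (real (b 0) - real (a 0)) - \<tau>\<bar> \<le> 1 / 4"
    using coord[of 0] Q1 unfolding Q_def
    by (simp add: dimension_def point_def direction_def algebra_simps)
  \<comment> \<open>The distance to the line and the timing error contribute at most 1/4 each, so
    the two integers differ by less than 1.\<close>
  have move: "int (b (Suc (j * p + i))) = int (a (Suc (j * p + i))) + n * speed a j i"
    if j: "j < J" "i < p" and n: "\<bar>\<tau> - of_int n * real (modulus j)\<bar> \<le> 1 / 4" for i j n
  proof -
    define m where "m = Suc (j * p + i)"
    define c where "c = of_int (speed a j i) / real (modulus j)"
    have c: "0 \<le> c" "c \<le> 1"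
    proof -
      show "0 \<le> c" unfolding c_def using speed_bounds(1)[of a j i] by simp
      have "real_of_int (speed a j i) \<le> real_of_int (int (modulus j))"
        using speed_bounds(2)[of a j i] unfolding of_int_le_iff .
      then show "c \<le> 1" unfolding c_def by simp
    qed
    have "\<bar>real (b m) - real (a m) - \<tau> * c\<bar> \<le> 1 / 4"
      using coord[OF direction_block(1)[OF j]] direction_block[OF j] Q1
      unfolding Q_def c_def m_def by (simp add: point_def)
    moreover have "\<bar>(\<tau> - of_int n * real (modulus j)) * c\<bar> \<le> 1 / 4 * 1"
      unfolding abs_mult using n c by (intro mult_mono) auto
    moreover have "real_of_int n * real (modulus j) * c = of_int (n * speed a j i)"
      unfolding c_def using modulus_pos[of j] by (simp del: modulus_pos)
    ultimately have "\<bar>real (b m) - real (a m) - of_int (n * speed a j i)\<bar> < 1"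
      unfolding left_diff_distrib by linarith
    then have "\<bar>real_of_int (int (b m) - int (a m) - n * speed a j i)\<bar> < 1" by simp
    then have "\<bar>int (b m) - int (a m) - n * speed a j i\<bar> < 1" by linarith
    then show ?thesis unfolding m_def by linarith
  qed
  have "\<exists>n::int. \<bar>\<tau> - of_int n * real (modulus j)\<bar> \<le> 1 / 4" if "j \<le> J" for j
    using that
  proof (induction j)
    case 0
    have "\<bar>\<tau> - of_int (int (b 0) - int (a 0)) * real (modulus 0)\<bar> \<le> 1 / 4"
      using clock by (simp add: mult.commute abs_minus_commute)
    then show ?case by blast
  next
    case (Suc j)
    then have j: "j < J" by simp
    obtain n where n: "\<bar>\<tau> - of_int n * real (modulus j)\<bar> \<le> 1 / 4" using Suc by auto
    have x: "block b j 0 = block a j 0 + n"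
      using move[OF j _ n, of 0] p_gt_1 unfolding block_def by (simp add: speed_def)
    \<comment> \<open>The motion uses the reduced slopes, so only a congruence holds for the
      original ones; it suffices because \<open>form\<close> is an integer polynomial.\<close>
    have w: "[block b j (Suc i) = block a j (Suc i) + n * slope a j i] (mod int (modulus j))"
      if "i < p - 1" for i
    proof -
      have "block b j (Suc i) = block a j (Suc i) + n * (slope a j i mod int (modulus j))"
        using move[OF j _ n, of "Suc i"] that unfolding block_def by (simp add: speed_def)
      moreover have "[slope a j i mod int (modulus j) = slope a j i] (mod int (modulus j))"
        by (simp add: cong_def)
      ultimately show ?thesis by (simp add: cong_add cong_mult)
    qed
    have "[form b j = (\<Sum>i<p - 1. (block a j (Suc i) + n * slope a j i) * (block a j 0 + n) ^ i)]
        (mod int (modulus j))"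
      unfolding form_def x by (intro cong_sum cong_mult w) auto
    then have "[form b j = form a j + n ^ (p - 1)] (mod int p ^ ((p - 1) * \<sigma> j))"
      unfolding sum_slope by (simp add: modulus_def)
    moreover have "digit_color p (form a j) l = digit_color p (form b j) l" if "l < \<sigma> j" for l
      using same j that unfolding same_color_def by blast
    ultimately have "int p ^ \<sigma> j dvd n"
      by (rule prime_power_dvd_if_same_digit_colors[OF prime_p])
    then obtain n' where "n = int p ^ \<sigma> j * n'" by blast
    then have "real_of_int n * real (modulus j) = of_int n' * real (modulus (Suc j))"
      using j by (simp add: modulus_Suc)
    then show ?case using n by metis
  qed
  then obtain n :: int where n: "\<bar>\<tau> - of_int n * Q\<bar> \<le> 1 / 4" unfolding Q_def by blast
  have m0: "real (modulus 0) \<ge> 1" using modulus_ge_1[of 0] by simp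
  have QJ: "Q = real (modulus 0) * real (p ^ (\<Sum>j<J. \<sigma> j))"
    unfolding Q_def modulus_eq by simp
  \<comment> \<open>The -1 matters: scaled, the difference is at most Q - 1, and two errors of 1/4
    still keep |n Q| below Q.\<close>
  have "\<bar>real (b 0) - real (a 0)\<bar> \<le> real (p ^ (\<Sum>j<J. \<sigma> j)) - 1"
    using grid_less(1)[OF a] grid_less(1)[OF b] by linarith
  then have "real (modulus 0) * \<bar>real (b 0) - real (a 0)\<bar> \<le> Q - real (modulus 0)"
    unfolding QJ using m0 mult_left_mono[of _ _ "real (modulus 0)"] by (fastforce simp: right_diff_distrib)
  then have "\<bar>real (modulus 0) * (real (b 0) - real (a 0))\<bar> \<le> Q - 1"
    using m0 by (simp add: abs_mult)
  then have "\<bar>of_int n * Q\<bar> < Q" using clock n by linarith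
  then have "n = 0" using Q1 by (simp add: abs_mult)
  then have \<tau>: "\<bar>\<tau>\<bar> \<le> 1 / 4" using n by simp
  have "a m = b m" if m: "m < dimension" for m
  proof (cases "m = 0")
    case True
    have "\<bar>real (modulus 0) * (real (b 0) - real (a 0))\<bar> < 1" using clock \<tau> by linarith
    moreover have "\<bar>real (b 0) - real (a 0)\<bar> \<le> real (modulus 0) * \<bar>real (b 0) - real (a 0)\<bar>"
      using m0 mult_right_mono[OF m0, of "\<bar>real (b 0) - real (a 0)\<bar>"] by simp
    ultimately have "\<bar>real (b 0) - real (a 0)\<bar> < 1" by (simp add: abs_mult)
    then have "a 0 = b 0" by linarith
    then show ?thesis using True by simp
  next
    case False
    then obtain j i where "j < J" "i < p" "m = Suc (j * p + i)" using m index_block by blast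
    then show ?thesis using move[of j i 0] \<tau> by simp
  qed
  then show ?thesis
    using a b unfolding grid_def by (intro PiE_ext) auto
qed

section \<open>Counting the grid and choosing a colour class\<close>

lemma finite_grid: "finite grid"
  unfolding grid_def by (intro finite_PiE) auto

lemma card_grid: "card grid = p ^ (\<Sum>j<J. \<sigma> j) * modulus J ^ (J * p)"
proof -
  have "card grid = (\<Prod>m<dimension. if m = 0 then p ^ (\<Sum>j<J. \<sigma> j) else modulus J)"
    unfolding grid_def by (subst card_PiE) (auto intro!: prod.cong)
  also have "\<dots> = p ^ (\<Sum>j<J. \<sigma> j) * (\<Prod>m<J * p. modulus J)"
    unfolding dimension_def by (subst prod.lessThan_Suc_shift) simp
  finally show ?thesis by simp
qed

text \<open>Pigeonhole: three colours for each pair (j, l) with l < \<sigma> j, and some colour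
  pattern is shared by at least the average number of grid points.\<close>

lemma exists_large_color_class:
  obtains S where "S \<subseteq> grid" "\<And>a b. a \<in> S \<Longrightarrow> b \<in> S \<Longrightarrow> same_color a b"
    "p ^ (\<Sum>j<J. \<sigma> j) * modulus J ^ (J * p) \<le> card S * 3 ^ (\<Sum>j<J. \<sigma> j)"
proof -
  define I where "I = (SIGMA j:{..<J}. {..<\<sigma> j})"
  define color where "color a = (\<lambda>(j, l)\<in>I. digit_color p (form a j) l)" for a
  define K where "K = (\<Pi>\<^sub>E _\<in>I. {..<3::nat})"
  have color: "color \<in> grid \<rightarrow> K"
    unfolding color_def K_def digit_color_def by (auto simp: cycle_color_less_3)
  have "(\<lambda>_\<in>I. 0) \<in> K" unfolding K_def by (intro restrict_PiE_iff[THEN iffD2]) simp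
  then have "K \<noteq> {}" by blast
  have "finite K" unfolding K_def I_def by (auto intro!: finite_PiE)
  have cardK: "card K = 3 ^ (\<Sum>j<J. \<sigma> j)"
    unfolding K_def I_def by (subst card_PiE) (auto simp: card_SigmaI)
  obtain y where y: "y \<in> K" "card grid \<le> card (color -` {y} \<inter> grid) * card K"
    using pigeonhole_card[OF color finite_grid \<open>finite K\<close> \<open>K \<noteq> {}\<close>] by blast
  show thesis
  proof
    show "color -` {y} \<inter> grid \<subseteq> grid" by blast
    show "p ^ (\<Sum>j<J. \<sigma> j) * modulus J ^ (J * p) \<le> card (color -` {y} \<inter> grid) * 3 ^ (\<Sum>j<J. \<sigma> j)"
      using y(2) unfolding cardK card_grid .
    fix a b assume "a \<in> color -` {y} \<inter> grid" "b \<in> color -` {y} \<inter> grid"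
    then have eq: "color a = color b" by simp
    show "same_color a b"
      unfolding same_color_def
    proof (intro allI impI)
      fix j l assume "j < J" "l < \<sigma> j"
      then have "(j, l) \<in> I" by (simp add: I_def)
      then show "digit_color p (form a j) l = digit_color p (form b j) l"
        using fun_cong[OF eq, of "(j, l)"] by (simp add: color_def)
    qed
  qed
qed

text \<open>Number the points of a large colour class. The distance to a line is attained, so too
  small a distance would identify two distinct points by \<open>eq_if_near_line\<close>.\<close>

lemma exists_separated_configuration:
  "\<exists>(n::nat) P L. (\<forall>i\<in>{1..n}. P i \<in> unit_cube dimension \<and> is_line dimension (L i) \<and> P i \<in> L i) \<and>
    (\<forall>i\<in>{1..n}. \<forall>j\<in>{1..n}. i \<noteq> j \<longrightarrow> dist_line (P i) (L j) > 1 / (4 * real (modulus J))) \<and>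
    p ^ (\<Sum>j<J. \<sigma> j) * modulus J ^ (J * p) \<le> n * 3 ^ (\<Sum>j<J. \<sigma> j)"
proof -
  obtain S where S: "S \<subseteq> grid" "\<And>a b. a \<in> S \<Longrightarrow> b \<in> S \<Longrightarrow> same_color a b"
    "p ^ (\<Sum>j<J. \<sigma> j) * modulus J ^ (J * p) \<le> card S * 3 ^ (\<Sum>j<J. \<sigma> j)"
    using exists_large_color_class by blast
  define n where "n = card S"
  have "finite S" using S(1) finite_grid by (rule finite_subset)
  then obtain f where f: "bij_betw f {1..n} S"
    unfolding n_def using finite_same_card_bij[of "{1..card S}" S] by auto
  have fS: "f i \<in> S" if "i \<in> {1..n}" for i using f that by (auto dest: bij_betwE)
  have "dist_line (point (f i)) (line (f j)) > 1 / (4 * real (modulus J))"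
    if ij: "i \<in> {1..n}" "j \<in> {1..n}" "i \<noteq> j" for i j
  proof (rule ccontr)
    assume small: "\<not> ?thesis"
    obtain q where "q \<in> line (f j)" "dist_line (point (f i)) (line (f j)) = sup_norm (point (f i) - q)"
      using dist_line_attained[OF point_carrier is_line_line] by blast
    then have "f j = f i"
      using small S(1,2) fS[OF ij(1)] fS[OF ij(2)] by (intro eq_if_near_line) auto
    then show False using f ij unfolding bij_betw_def inj_on_def by metis
  qed
  moreover have "point (f i) \<in> unit_cube dimension" if "i \<in> {1..n}" for i
    using fS[OF that] S(1) by (intro point_in_unit_cube) auto
  ultimately show ?thesis
    using S(3) unfolding n_def [symmetric]
    by (intro exI[of _ n] exI[of _ "\<lambda>i. point (f i)"] exI[of _ "\<lambda>i. line (f i)"])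
      (auto simp: is_line_line point_in_line)
qed

end

section \<open>Failure of \<open>PL\<close>\<close>

text \<open>As 1/(d-\<gamma>) exceeds 1/(d-\<gamma>'), the distance promised by \<open>PL\<close>
  falls below 1/Q by a power of \<open>Q\<close>, which for large \<open>Q\<close> beats the factor
  4.\<close>

lemma not_PL_if_separated_configurations:
  fixes \<gamma> \<gamma>' :: real
  assumes \<gamma>: "\<gamma>' < \<gamma>" "\<gamma> < real d"
    and conf: "\<And>B::real. \<exists>Q\<ge>B. \<exists>(n::nat) P L. Q powr (real d - \<gamma>') \<le> real n \<and>
      (\<forall>i\<in>{1..n}. P i \<in> unit_cube d \<and> is_line d (L i) \<and> P i \<in> L i) \<and>
      (\<forall>i\<in>{1..n}. \<forall>j\<in>{1..n}. i \<noteq> j \<longrightarrow> dist_line (P i) (L j) > 1 / (4 * Q))"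
  shows "\<not> PL d \<gamma>"
proof
  assume "PL d \<gamma>"
  then obtain \<epsilon> :: "nat \<Rightarrow> real" where \<epsilon>: "\<epsilon> \<longlonglongrightarrow> 0"
    and ev: "\<forall>\<^sub>F n in sequentially. \<forall>(p :: nat \<Rightarrow> real vec) l.
        (\<forall>i\<in>{1..n}. p i \<in> unit_cube d \<and> is_line d (l i) \<and> p i \<in> l i) \<longrightarrow>
        (\<exists>i\<in>{1..n}. \<exists>j\<in>{1..n}. i \<noteq> j \<and>
          dist_line (p i) (l j) \<le> real n powr (- (1 / (real d - \<gamma>)) + \<epsilon> n))"
    unfolding PL_def by blast
  define \<alpha> where "\<alpha> = real d - \<gamma>'"
  \<comment> \<open>Half the gap between the exponents: one half absorbs
    \<open>\<epsilon> n\<close>, the other yields the saving Q^(-\<kappa>\<alpha>).\<close>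
  define \<kappa> where "\<kappa> = (1 / (real d - \<gamma>) - 1 / \<alpha>) / 2"
  have \<alpha>: "\<alpha> > 0" unfolding \<alpha>_def using \<gamma> by simp
  have "1 / \<alpha> < 1 / (real d - \<gamma>)"
    unfolding \<alpha>_def using \<gamma> by (intro divide_strict_left_mono) auto
  then have \<kappa>: "\<kappa> > 0" unfolding \<kappa>_def by simp
  have "\<forall>\<^sub>F n in sequentially. \<epsilon> n < \<kappa>" using \<epsilon> \<kappa> by (rule order_tendstoD)
  with ev have "\<forall>\<^sub>F n in sequentially. (\<forall>(p :: nat \<Rightarrow> real vec) l.
        (\<forall>i\<in>{1..n}. p i \<in> unit_cube d \<and> is_line d (l i) \<and> p i \<in> l i) \<longrightarrow>
        (\<exists>i\<in>{1..n}. \<exists>j\<in>{1..n}. i \<noteq> j \<and>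
          dist_line (p i) (l j) \<le> real n powr (- (1 / (real d - \<gamma>)) + \<epsilon> n))) \<and> \<epsilon> n < \<kappa>"
    by (rule eventually_conj)
  then obtain N where N: "\<And>n (p :: nat \<Rightarrow> real vec) l. n \<ge> N \<Longrightarrow>
        (\<forall>i\<in>{1..n}. p i \<in> unit_cube d \<and> is_line d (l i) \<and> p i \<in> l i) \<Longrightarrow>
        (\<exists>i\<in>{1..n}. \<exists>j\<in>{1..n}. i \<noteq> j \<and>
          dist_line (p i) (l j) \<le> real n powr (- (1 / (real d - \<gamma>)) + \<epsilon> n))"
      "\<And>n. n \<ge> N \<Longrightarrow> \<epsilon> n < \<kappa>"
    unfolding eventually_sequentially by blast
  \<comment> \<open>\<open>B1\<close> forces n >= N, and \<open>B2\<close> forces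
    Q^(\<kappa>\<alpha>) >= 4.\<close>
  define B1 where "B1 = (real N + 1) powr (1 / \<alpha>)"
  define B2 where "B2 = 4 powr (1 / (\<kappa> * \<alpha>))"
  obtain Q n P L where Q: "Q \<ge> max B1 B2" and n: "Q powr \<alpha> \<le> real n"
    and inc: "\<forall>i\<in>{1..n}. P i \<in> unit_cube d \<and> is_line d (L i) \<and> P i \<in> L i"
    and sep: "\<forall>i\<in>{1..n}. \<forall>j\<in>{1..n}. i \<noteq> j \<longrightarrow> dist_line (P i) (L j) > 1 / (4 * Q)"
    using conf[of "max B1 B2"] unfolding \<alpha>_def by blast
  have B: "B1 > 0" "B2 > 0" unfolding B1_def B2_def by simp_all
  then have Q0: "Q > 0" using Q by linarith
  have "real N + 1 = B1 powr \<alpha>" unfolding B1_def using \<alpha> by (simp add: powr_powr)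
  also have "\<dots> \<le> Q powr \<alpha>" using Q B \<alpha> by (intro powr_mono2) auto
  finally have nN: "real N + 1 \<le> real n" using n by simp
  have "4 = B2 powr (\<kappa> * \<alpha>)" unfolding B2_def using \<alpha> \<kappa> by (simp add: powr_powr)
  also have "\<dots> \<le> Q powr (\<kappa> * \<alpha>)" using Q B \<alpha> \<kappa> by (intro powr_mono2) auto
  finally have Q4: "4 \<le> Q powr (\<kappa> * \<alpha>)" .
  have NN: "N \<le> n" using nN by linarith
  from N(1)[OF this inc] obtain i j where ij: "i \<in> {1..n}" "j \<in> {1..n}" "i \<noteq> j"
    "dist_line (P i) (L j) \<le> real n powr (- (1 / (real d - \<gamma>)) + \<epsilon> n)" by blast
  note ij(4)
  also have "real n powr (- (1 / (real d - \<gamma>)) + \<epsilon> n) \<le> real n powr (- (1 / \<alpha> + \<kappa>))"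
  proof (rule powr_mono)
    have "u = v + 2 * ((u - v) / 2)" for u v :: real by (simp add: field_simps)
    then have "1 / (real d - \<gamma>) = 1 / \<alpha> + 2 * \<kappa>" unfolding \<kappa>_def .
    then show "- (1 / (real d - \<gamma>)) + \<epsilon> n \<le> - (1 / \<alpha> + \<kappa>)" using N(2)[OF NN] by simp
  qed (use nN in simp)
  also have "\<dots> \<le> (Q powr \<alpha>) powr (- (1 / \<alpha> + \<kappa>))"
  proof (rule powr_mono2')
    have "1 / \<alpha> > 0" using \<alpha> by simp
    then show "- (1 / \<alpha> + \<kappa>) \<le> 0" using \<kappa> by linarith
  qed (use n Q0 in auto)
  also have "\<dots> = Q powr (- 1) * Q powr (- (\<kappa> * \<alpha>))"
  proof -
    have "\<alpha> * (- (1 / \<alpha> + \<kappa>)) = - 1 + - (\<kappa> * \<alpha>)" using \<alpha> by (simp add: algebra_simps)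
    then show ?thesis by (simp only: powr_powr powr_add)
  qed
  also have "\<dots> = 1 / (Q * Q powr (\<kappa> * \<alpha>))" using Q0 by (simp add: powr_minus divide_simps)
  also have "\<dots> \<le> 1 / (Q * 4)" using Q4 Q0 by (intro divide_left_mono mult_left_mono) auto
  finally have "dist_line (P i) (L j) \<le> 1 / (4 * Q)" by (simp add: mult.commute)
  then show False using sep ij(1-3) by fastforce
qed

section \<open>Choice of parameters\<close>

text \<open>With \<alpha> = ln 3 / ln p and \<beta> = (1 - 1/p)^J, the tower has p^\<Sigma> =
  Q^(1-\<beta>) and 3^\<Sigma> = Q^(\<alpha>(1-\<beta>)). A colour class thus has at least Q^(Jp +
  (1-\<alpha>)(1-\<beta>)) points, and (1-\<alpha>)(1-\<beta>) >= 1 - \<alpha> - \<beta>.\<close>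

lemma not_PL_prime:
  fixes p J :: nat and \<gamma> :: real
  assumes p: "prime p" "p \<ge> 3"
    and \<gamma>: "ln 3 / ln (real p) + (1 - 1 / real p) ^ J < \<gamma>" "\<gamma> < real (Suc (J * p))"
  shows "\<not> PL (Suc (J * p)) \<gamma>"
proof (rule not_PL_if_separated_configurations[OF \<gamma>])
  fix B :: real
  define s where "s = nat \<lceil>B\<rceil> + 1"
  \<comment> \<open>A geometric solution of the recurrence: the powers of p-1 keep it integral up to
    level \<open>J\<close>, and the free factor \<open>s\<close> makes Q >= B.\<close>
  define \<sigma> where "\<sigma> j = s * (p - 1) ^ (J - j) * p ^ j" for j
  interpret digit_tower p J \<sigma>
  proof
    fix j assume "j < J"
    then have "J - j = Suc (J - Suc j)" by simp
    then show "(p - 1) * \<sigma> (Suc j) = p * \<sigma> j" unfolding \<sigma>_def by simp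
  qed (fact p)
  define Q where "Q = real (modulus J)"
  define E where "E = real ((p - 1) * \<sigma> J)"
  define \<Sigma> where "\<Sigma> = (\<Sum>j<J. \<sigma> j)"
  define \<alpha> where "\<alpha> = ln 3 / ln (real p)"
  define \<beta> where "\<beta> = (1 - 1 / real p) ^ J"
  have p3: "real p \<ge> 3" using p by simp
  have lnp: "ln (real p) > 0" using p3 by simp
  have \<alpha>: "\<alpha> \<ge> 0" unfolding \<alpha>_def using lnp by simp
  have \<beta>: "\<beta> \<ge> 0" unfolding \<beta>_def using p3 by simp
  have Q0: "Q > 0" unfolding Q_def by simp
  have lnQ: "ln Q = E * ln (real p)"
    unfolding Q_def E_def modulus_def using p3 by (simp add: ln_realpow)
  have E0: "E \<ge> 0" unfolding E_def by simp
  have "real \<Sigma> = E - real ((p - 1) * \<sigma> 0)"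
    unfolding \<Sigma>_def E_def sum_\<sigma>[OF order_refl] by simp
  also have "real ((p - 1) * \<sigma> 0) = E * \<beta>"
    unfolding E_def \<beta>_def \<sigma>_def using p3
    by (simp add: field_simps of_nat_diff flip: power_mult_distrib)
  finally have \<Sigma>: "real \<Sigma> = E * (1 - \<beta>)" by (simp add: algebra_simps)
  have "B \<le> real s" unfolding s_def by linarith
  also have "s \<le> (p - 1) * \<sigma> J"
  proof -
    have "1 * (s * 1) \<le> (p - 1) * (s * p ^ J)" using p by (intro mult_le_mono) auto
    then show ?thesis unfolding \<sigma>_def by simp
  qed
  also have "\<dots> \<le> modulus J"
    unfolding modulus_def using p by (intro less_imp_le power_gt_expt) simp
  finally have BQ: "B \<le> Q" unfolding Q_def by simp
  obtain n P L where config: "\<forall>i\<in>{1..n}. P i \<in> unit_cube dimension \<and> is_line dimension (L i) \<and> P i \<in> L i"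
      "\<forall>i\<in>{1..n}. \<forall>j\<in>{1..n}. i \<noteq> j \<longrightarrow> dist_line (P i) (L j) > 1 / (4 * real (modulus J))"
    and card: "p ^ \<Sigma> * modulus J ^ (J * p) \<le> n * 3 ^ \<Sigma>"
    using exists_separated_configuration unfolding \<Sigma>_def by blast
  have dim: "dimension = Suc (J * p)" by (simp add: dimension_def)
  have "Q powr (real (Suc (J * p)) - (\<alpha> + \<beta>)) = Q ^ (J * p) * Q powr (1 - (\<alpha> + \<beta>))"
  proof -
    have "real (Suc (J * p)) - (\<alpha> + \<beta>) = real (J * p) + (1 - (\<alpha> + \<beta>))" by simp
    then show ?thesis using Q0 by (simp only: powr_add powr_realpow)
  qed
  also have "Q powr (1 - (\<alpha> + \<beta>)) \<le> (real p / 3) ^ \<Sigma>"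
  proof -
    have "(1 - (\<alpha> + \<beta>)) * ln Q = (1 - (\<alpha> + \<beta>)) * (E * ln (real p))" by (simp add: lnQ)
    also have "\<dots> \<le> ((1 - \<alpha>) * (1 - \<beta>)) * (E * ln (real p))"
      using \<alpha> \<beta> E0 lnp by (intro mult_right_mono) (simp_all add: algebra_simps)
    also have "\<dots> = real \<Sigma> * ((1 - \<alpha>) * ln (real p))" unfolding \<Sigma> by simp
    also have "(1 - \<alpha>) * ln (real p) = ln (real p / 3)"
      unfolding \<alpha>_def using p3 lnp by (simp add: ln_div left_diff_distrib)
    finally have "(1 - (\<alpha> + \<beta>)) * ln Q \<le> ln ((real p / 3) ^ \<Sigma>)"
      using p3 by (simp add: ln_realpow)
    then have "exp ((1 - (\<alpha> + \<beta>)) * ln Q) \<le> exp (ln ((real p / 3) ^ \<Sigma>))" by simp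
    then show ?thesis using Q0 p3 by (simp add: powr_def)
  qed
  also have "Q ^ (J * p) * (real p / 3) ^ \<Sigma> \<le> real n"
  proof -
    have "real (p ^ \<Sigma> * modulus J ^ (J * p)) \<le> real (n * 3 ^ \<Sigma>)"
      using card unfolding of_nat_le_iff .
    then show ?thesis unfolding Q_def by (simp add: power_divide field_simps)
  qed
  finally have "Q powr (real (Suc (J * p)) - (\<alpha> + \<beta>)) \<le> real n"
    using Q0 by simp
  then show "\<exists>Q\<ge>B. \<exists>(n::nat) P L. Q powr (real (Suc (J * p)) - (ln 3 / ln (real p) + (1 - 1 / real p) ^ J)) \<le> real n \<and>
      (\<forall>i\<in>{1..n}. P i \<in> unit_cube (Suc (J * p)) \<and> is_line (Suc (J * p)) (L i) \<and> P i \<in> L i) \<and>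
      (\<forall>i\<in>{1..n}. \<forall>j\<in>{1..n}. i \<noteq> j \<longrightarrow> dist_line (P i) (L j) > 1 / (4 * Q))"
    using BQ config unfolding dim \<alpha>_def \<beta>_def Q_def by blast
qed

text \<open>A prime with ln p > 4/\<gamma> makes the first error term less than \<gamma>/2, since ln
  3 <= 2; J = p^2 makes the second at most exp(-p) < \<gamma>/4. The dimension 1 + p^3 is at most 54
  X^6.\<close>

lemma exists_dimension_not_PL:
  fixes \<gamma> :: real
  assumes \<gamma>: "\<gamma> > 0"
  shows "\<exists>d. d \<ge> 1 \<and> \<not> PL d \<gamma> \<and> ln (real d) \<le> 59 + 6 * \<gamma> + 24 / \<gamma>"
proof -
  \<comment> \<open>The summand \<gamma> serves large \<gamma>: it makes p > \<gamma>, hence the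
    dimension exceeds \<gamma>.\<close>
  define X where "X = nat \<lceil>exp (4 / \<gamma>) + \<gamma>\<rceil>"
  have X: "exp (4 / \<gamma>) + \<gamma> \<le> real X" "real X \<le> exp (4 / \<gamma>) + \<gamma> + 1"
    unfolding X_def using \<gamma> exp_gt_zero[of "4 / \<gamma>"] by linarith+
  have e1: "exp (4 / \<gamma>) > 1" using \<gamma> by simp
  then have X2: "X \<ge> 2" using X \<gamma> by linarith
  then obtain p where p: "prime p" "X < p" "p \<le> 2 * X\<^sup>2 + 1"
    using exists_prime_between[of X] by auto
  have p3: "p \<ge> 3" using p X2 by simp
  have pX: "real p > exp (4 / \<gamma>)" "real p > \<gamma>" using X p(2) \<gamma> e1 by linarith+
  then have lnp: "ln (real p) > 4 / \<gamma>"
    by (metis exp_gt_zero less_trans ln_exp ln_less_cancel_iff)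
  define J where "J = p ^ 2"
  have "ln 3 / ln (real p) < \<gamma> / 2"
  proof -
    have "ln (3::real) \<le> 3 - 1" by (intro ln_le_minus_one) simp
    moreover have "4 < ln (real p) * \<gamma>" using lnp \<gamma> by (simp add: field_simps)
    moreover have "ln (real p) > 0" using lnp \<gamma> by (meson divide_pos_pos less_trans zero_less_numeral)
    ultimately show ?thesis by (simp add: field_simps)
  qed
  moreover have "(1 - 1 / real p) ^ J < \<gamma> / 4"
  proof -
    have "(1 - 1 / real p) ^ J \<le> exp (- 1 / real p) ^ J"
      using p3 exp_ge_add_one_self[of "- 1 / real p"] by (intro power_mono) auto
    also have "\<dots> = exp (- real p)"
      unfolding J_def using p3 by (simp add: power2_eq_square flip: exp_of_nat_mult)
    also have "\<dots> \<le> 1 / real p"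
      using exp_ge_add_one_self[of "real p"] p3
      by (simp add: exp_minus inverse_eq_divide frac_le del: exp_ge_add_one_self)
    also have "\<dots> < \<gamma> / 4"
    proof -
      have "4 / \<gamma> < real p" using lnp ln_le_minus_one[of "real p"] p3 by simp
      then show ?thesis using \<gamma> p3 by (simp add: field_simps)
    qed
    finally show ?thesis .
  qed
  ultimately have "ln 3 / ln (real p) + (1 - 1 / real p) ^ J < \<gamma>" using \<gamma> by linarith
  moreover have "\<gamma> < real (Suc (J * p))"
  proof -
    have "p \<le> Suc (J * p)" unfolding J_def using p3 by (simp add: le_SucI)
    then have "real p \<le> real (Suc (J * p))" unfolding of_nat_le_iff .
    then show ?thesis using pX by linarith
  qed
  ultimately have "\<not> PL (Suc (J * p)) \<gamma>" using p(1) p3 by (intro not_PL_prime)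
  moreover have "ln (real (Suc (J * p))) \<le> 59 + 6 * \<gamma> + 24 / \<gamma>"
  proof -
    have "Suc (J * p) \<le> 2 * p ^ 3"
      unfolding J_def using p3 one_le_power[of p 3] by (simp add: power2_eq_square power3_eq_cube)
    also have "\<dots> \<le> 2 * (3 * X\<^sup>2) ^ 3"
    proof -
      have "1 \<le> X\<^sup>2" using X2 by simp
      then have "p \<le> 3 * X\<^sup>2" using p(3) by linarith
      then show ?thesis by (intro mult_left_mono power_mono) auto
    qed
    also have "\<dots> = 54 * X ^ 6" by (simp add: power_mult_distrib flip: power_mult)
    finally have "real (Suc (J * p)) \<le> real (54 * X ^ 6)" unfolding of_nat_le_iff .
    also have "\<dots> = 54 * real X ^ 6" by simp
    \<comment> \<open>The constant 59 is 53, from the crude bound 54 <= exp 53, plus 6 from the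
      sixth power of exp(4/\<gamma> + \<gamma> + 1).\<close>
    also have "\<dots> \<le> exp 53 * exp (4 / \<gamma> + (\<gamma> + 1)) ^ 6"
    proof (intro mult_mono power_mono)
      show "(54::real) \<le> exp 53" using exp_ge_add_one_self[of "53::real"] by simp
      have "real X \<le> exp (4 / \<gamma>) + (\<gamma> + 1)" using X by simp
      also have "\<dots> \<le> exp (4 / \<gamma>) + exp (4 / \<gamma>) * (\<gamma> + 1)"
        using e1 \<gamma> by simp
      also have "\<dots> = exp (4 / \<gamma>) * (1 + (\<gamma> + 1))" by (simp add: algebra_simps)
      also have "\<dots> \<le> exp (4 / \<gamma>) * exp (\<gamma> + 1)"
        using exp_ge_add_one_self[of "\<gamma> + 1"] by (intro mult_left_mono) auto
      finally show "real X \<le> exp (4 / \<gamma> + (\<gamma> + 1))" by (simp add: exp_add)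
    qed auto
    also have "\<dots> = exp (59 + 6 * \<gamma> + 24 / \<gamma>)"
      by (simp add: algebra_simps flip: exp_of_nat_mult exp_add)
    finally have "ln (real (Suc (J * p))) \<le> ln (exp (59 + 6 * \<gamma> + 24 / \<gamma>))"
      by (intro ln_mono) (simp_all del: of_nat_Suc)
    then show ?thesis by simp
  qed
  ultimately show ?thesis by (intro exI[of _ "Suc (J * p)"]) simp
qed

text \<open>Bounded ranges of \<gamma> are forced: \<open>PL\<close> holds vacuously in dimension 0,
  and also in dimension 1, where the only line is the whole space. So d0 >= 2, and ln d0 cannot
  decay like 1/\<gamma> for large \<gamma>.\<close>

theorem corollary1p17:
  shows "\<exists>(d0 :: real \<Rightarrow> nat) (f :: real \<Rightarrow> real).
    (\<forall>\<gamma>>0. \<not> PL (d0 \<gamma>) \<gamma> \<and> real (d0 \<gamma>) = exp (f \<gamma>)) \<and>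
    (\<forall>\<Gamma>>0. \<exists>C>0. \<forall>\<gamma>\<in>{0<..\<Gamma>}. \<bar>f \<gamma>\<bar> \<le> C * (1 / \<gamma>))"
proof -
  obtain d0 :: "real \<Rightarrow> nat" where d0: "\<And>\<gamma>. \<gamma> > 0 \<Longrightarrow>
      d0 \<gamma> \<ge> 1 \<and> \<not> PL (d0 \<gamma>) \<gamma> \<and> ln (real (d0 \<gamma>)) \<le> 59 + 6 * \<gamma> + 24 / \<gamma>"
    using exists_dimension_not_PL by metis
  have "\<exists>C>0. \<forall>\<gamma>\<in>{0<..\<Gamma>}. \<bar>ln (real (d0 \<gamma>))\<bar> \<le> C * (1 / \<gamma>)" if \<Gamma>: "\<Gamma> > 0" for \<Gamma>
  \<comment> \<open>The constant is \<gamma> (59 + 6 \<gamma> + 24/\<gamma>) at \<gamma> =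
    \<Gamma>.\<close>
  proof (intro exI[of _ "59 * \<Gamma> + 6 * \<Gamma>\<^sup>2 + 24"] conjI ballI)
    show "0 < 59 * \<Gamma> + 6 * \<Gamma>\<^sup>2 + 24" using \<Gamma> by (simp add: add_pos_nonneg)
    fix \<gamma> assume "\<gamma> \<in> {0<..\<Gamma>}"
    then have \<gamma>: "0 < \<gamma>" "\<gamma> \<le> \<Gamma>" by auto
    have "0 \<le> ln (real (d0 \<gamma>))" using d0[OF \<gamma>(1)] by simp
    moreover have "59 + 6 * \<gamma> + 24 / \<gamma> \<le> (59 * \<Gamma> + 6 * \<Gamma>\<^sup>2 + 24) * (1 / \<gamma>)"
    proof -
      have "\<gamma>\<^sup>2 \<le> \<Gamma>\<^sup>2" using \<gamma> by (intro power_mono) auto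
      then have "59 * \<gamma> + 6 * \<gamma>\<^sup>2 + 24 \<le> 59 * \<Gamma> + 6 * \<Gamma>\<^sup>2 + 24" using \<gamma> by linarith
      then have "(59 * \<gamma> + 6 * \<gamma>\<^sup>2 + 24) * (1 / \<gamma>) \<le> (59 * \<Gamma> + 6 * \<Gamma>\<^sup>2 + 24) * (1 / \<gamma>)"
        using \<gamma> by (intro mult_right_mono) auto
      moreover have "(59 * \<gamma> + 6 * \<gamma>\<^sup>2 + 24) * (1 / \<gamma>) = 59 + 6 * \<gamma> + 24 / \<gamma>"
        using \<gamma> by (simp add: field_simps power2_eq_square)
      ultimately show ?thesis by simp
    qed
    ultimately show "\<bar>ln (real (d0 \<gamma>))\<bar> \<le> (59 * \<Gamma> + 6 * \<Gamma>\<^sup>2 + 24) * (1 / \<gamma>)"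
      using d0[OF \<gamma>(1)] by linarith
  qed
  moreover have "real (d0 \<gamma>) = exp (ln (real (d0 \<gamma>)))" if "\<gamma> > 0" for \<gamma>
    using d0[OF that] by simp
  ultimately show ?thesis
    using d0 by (intro exI[of _ d0] exI[of _ "\<lambda>\<gamma>. ln (real (d0 \<gamma>))"]) blast
qed

end
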